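(* Let $(q,n)$ be a Dickson pair with $q=p^l$ for some prime $p$ and positive integers $l,n$. Let $g$ be a generator of the multiplicative group $\mathbb{F}_{q^n}^*$ and let $R=(\mathbb{F}_{q^n},+,\circ)$ be the finite Dickson nearfield constructed with $H=\langle g^n\rangle$. Let $\mathbb{F}_q$ be the unique subfield of order $q$ of the field $\mathbb{F}_{q^n}$. Then $$\mathbb{F}_q\subseteq C(R).$$
   Context: A pair of positive integers $(q,n)$ is called a Dickson pair if: (i) $q$ is a power $p^l$ of some prime $p$; (ii) each prime divisor of $n$ divides $q-1$; (iii) $q\equiv 3 \pmod 4$ implies that $4$ does not divide $n$. For $k\in\{1,\ldots,n\}$ write $[k]_q=\frac{q^k-1}{q-1}$. A (left) nearfield is a triple $(R,+,\cdot)$ such that $(R,+)$ is a group, $(R,\cdot)$ is a semigroup, $a\cdot(b+c)=a\cdot b+a\cdot c$ for all $a,b,c\in R$, and $(R\setminus\{0\},\cdot)$ is a group. Dickson construction: let $(q,n)$ be a Dickson pair, let $g$ be a generator of the multiplicative group $\mathbb{F}_{q^n}^*$ of the finite field $\mathbb{F}_{q^n}$ (with usual multiplication $\cdot$), and let $H=\langle g^n\rangle\le \mathbb{F}_{q^n}^*$. The quotient group is $\mathbb{F}_{q^n}^*/H=\{g^{[1]_q}H,g^{[2]_q}H,\ldots,g^{[n]_q}H\}=\{H,gH,\ldots,g^{n-1}H\}$, so each $\alpha\in\mathbb{F}_{q^n}^*$ lies in $g^{[k]_q}H$ for exactly one $k\in\{1,\ldots,n\}$. Define a new multiplication on $\mathbb{F}_{q^n}$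 by $$\alpha\circ\beta=\begin{cases}\alpha\cdot\beta^{q^k} & \text{if } \alpha\in g^{[k]_q}H,\ k\in\{1,\ldots,n\},\\ 0 & \text{if }\alpha=0.\end{cases}$$ Then $(\mathbb{F}_{q^n},+,\circ)$ is a (left) nearfield, the finite Dickson nearfield arising from the Dickson pair $(q,n)$ with generator $g$, i.e. constructed with $H=\langle g^n\rangle$. For this nearfield $R=(\mathbb{F}_{q^n},+,\circ)$, the multiplicative center is $C(R)=\{x\in R: x\circ y=y\circ x\text{ for all }y\in R\}$. The field $\mathbb{F}_q$ is regarded as a subset of the underlying set $\mathbb{F}_{q^n}$ of $R$. *)

theory Defs
  imports "HOL-Algebra.Multiplicative_Group" "HOL-Algebra.Generated_Groups" "HOL-Algebra.Subrings"
    "HOL-Computational_Algebra.Primes"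
begin

definition dickson_pair :: "nat \<Rightarrow> nat \<Rightarrow> bool" where
  "dickson_pair q n \<longleftrightarrow>
     q > 0 \<and> n > 0 \<and>
     (\<exists>p l. prime p \<and> l > 0 \<and> q = p ^ l) \<and>
     (\<forall>r. prime r \<and> r dvd n \<longrightarrow> r dvd q - 1) \<and>
     (q mod 4 = 3 \<longrightarrow> \<not> 4 dvd n)"

text \<open>For \<open>q \<ge> 2\<close> the natural-number division below is exact.\<close>

definition q_bracket :: "nat \<Rightarrow> nat \<Rightarrow> nat" where
  "q_bracket q k = (q ^ k - 1) div (q - 1)"

definition dickson_H :: "('a, 'b) ring_scheme \<Rightarrow> nat \<Rightarrow> 'a \<Rightarrow> 'a set" where
  "dickson_H F n g = generate (mult_of F) {g [^]\<^bsub>mult_of F\<^esub> n}"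

text \<open>The definite description is meaningful when \<open>(q, n)\<close> is a Dickson pair, \<open>F\<close> is a field
  of order \<open>q ^ n\<close>, \<open>g\<close> generates its multiplicative group and \<open>\<alpha>\<close> is a nonzero element: then
  the cosets of \<open>g\<close> to the powers \<open>q_bracket q 1, \<dots>, q_bracket q n\<close> partition the nonzero elements.\<close>

definition dickson_index :: "('a, 'b) ring_scheme \<Rightarrow> nat \<Rightarrow> nat \<Rightarrow> 'a \<Rightarrow> 'a \<Rightarrow> nat" where
  "dickson_index F q n g \<alpha> =
     (THE k. k \<in> {1..n} \<and>
        \<alpha> \<in> (g [^]\<^bsub>mult_of F\<^esub> q_bracket q k) <#\<^bsub>mult_of F\<^esub> dickson_H F n g)"

definition dickson_mult ::
    "('a, 'b) ring_scheme \<Rightarrow> nat \<Rightarrow> nat \<Rightarrow> 'a \<Rightarrow> 'a \<Rightarrow> 'a \<Rightarrow> 'a" where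
  "dickson_mult F q n g \<alpha> \<beta> =
     (if \<alpha> = \<zero>\<^bsub>F\<^esub> then \<zero>\<^bsub>F\<^esub>
      else \<alpha> \<otimes>\<^bsub>F\<^esub> (\<beta> [^]\<^bsub>F\<^esub> (q ^ dickson_index F q n g \<alpha>)))"

text \<open>The ring record serves only as a signature here; a left nearfield need not be right
  distributive, so this structure is in general not a ring.\<close>

definition dickson_nearfield ::
    "('a, 'b) ring_scheme \<Rightarrow> nat \<Rightarrow> nat \<Rightarrow> 'a \<Rightarrow> ('a, 'b) ring_scheme" where
  "dickson_nearfield F q n g = F\<lparr>mult := dickson_mult F q n g\<rparr>"

definition mult_center :: "('a, 'b) monoid_scheme \<Rightarrow> 'a set" where
  "mult_center R =
     {x \<in> carrier R. \<forall>y \<in> carrier R. x \<otimes>\<^bsub>R\<^esub> y = y \<otimes>\<^bsub>R\<^esub> x}"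

end

theory Submission
  imports Defs "HOL-Number_Theory.Cong"
begin

text \<open>
  If \<open>x\<close> is a nonzero element of the subfield of order \<open>q\<close>, then \<open>x\<close> is fixed by every power of
  the \<open>q\<close>-Frobenius, so \<open>y \<circ> x = y x\<close> for all \<open>y\<close>. Conversely \<open>x \<circ> y = x y\<close> as soon as the index
  \<open>k\<close> of \<open>x\<close> is \<open>n\<close>, because \<open>y\<close> is fixed by the \<open>q ^ n\<close>-th power map. Since \<open>x ^ (q - 1) = 1\<close>,
  \<open>x\<close> is a power of \<open>g\<close> with exponent divisible by \<open>1 + q + \<dots> + q ^ (n - 1)\<close>. So
  everything rests on the arithmetic of Dickson pairs: \<open>n\<close> divides \<open>1 + q + \<dots> + q ^ (k - 1)\<close> if and
  only if \<open>n\<close> divides \<open>k\<close>. This is shown by splitting off one prime \<open>r\<close> of \<open>n\<close> at a time, passing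
  from \<open>(q, n)\<close> to \<open>(q ^ r, n / r)\<close>.
\<close>

section \<open>Divisibility of geometric sums\<close>

text \<open>Each exponent below \<open>a * b\<close> is uniquely \<open>i + a * j\<close> with
  \<open>i < a\<close> and \<open>j < b\<close>. Taking \<open>a = r\<close> produces the sum for
  \<open>q ^ r\<close>.\<close>

lemma sum_powers_mult:
  fixes q :: "'a :: comm_semiring_1"
  shows "(\<Sum>i<a * b. q ^ i) = (\<Sum>i<a. q ^ i) * (\<Sum>j<b. (q ^ a) ^ j)"
proof (induction b)
  case (Suc b)
  have "(\<Sum>i<m + a. q ^ i) = (\<Sum>i<m. q ^ i) + q ^ m * (\<Sum>i<a. q ^ i)" for m
    by (induction a) (simp_all add: algebra_simps power_add)
  from this[of "a * b"] Suc show ?case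
    by (simp add: algebra_simps power_mult)
qed simp

lemma power_minus_1_eq_sum_nat:
  fixes q :: nat
  shows "q ^ k - 1 = (q - 1) * (\<Sum>i<k. q ^ i)"
proof (cases q)
  case (Suc d)
  have "q ^ k = Suc (d * (\<Sum>i<k. q ^ i))"
    by (induction k) (simp_all add: Suc algebra_simps)
  then show ?thesis using Suc by simp
qed (simp add: power_0_left)

lemma sum_powers_cong:
  fixes q m :: nat
  assumes "[q = 1] (mod m)"
  shows "[(\<Sum>i<k. q ^ i) = k] (mod m)"
proof -
  have "[(\<Sum>i<k. q ^ i) = (\<Sum>i<k. 1)] (mod m)"
    using assms cong_pow[of q 1 m] by (intro cong_sum) simp
  then show ?thesis by simp
qed

text \<open>This is the binomial expansion to first order: all later terms contain
  \<open>r\<^sup>2\<close>.\<close>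

lemma sum_powers_cong_square:
  fixes t r :: nat
  shows "[(\<Sum>i<k. (1 + r * t) ^ i) = k + r * t * (\<Sum>i<k. i)] (mod r\<^sup>2)"
proof -
  have "[(1 + r * t) ^ i = 1 + i * r * t] (mod r\<^sup>2)" for i
  proof (induction i)
    case (Suc i)
    have "[(1 + r * t) * (1 + r * t) ^ i = (1 + r * t) * (1 + i * r * t)] (mod r\<^sup>2)"
      using Suc by (rule cong_scalar_left)
    moreover have "(1 + r * t) * (1 + i * r * t) = (1 + Suc i * r * t) + r\<^sup>2 * (i * t\<^sup>2)"
      by (simp add: algebra_simps power2_eq_square)
    ultimately show ?case
      by (simp add: cong_def del: mult_Suc)
  qed simp
  then have "[(\<Sum>i<k. (1 + r * t) ^ i) = (\<Sum>i<k. 1 + i * r * t)] (mod r\<^sup>2)"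
    by (intro cong_sum)
  moreover have "(\<Sum>i<k. 1 + i * r * t) = k + r * t * (\<Sum>i<k. i)"
    by (simp only: sum.distrib sum_distrib_left) (simp add: algebra_simps)
  ultimately show ?thesis by simp
qed

text \<open>For odd \<open>r\<close> the first-order correction
  \<open>r * t * (r * (r - 1) / 2)\<close> vanishes modulo \<open>r\<^sup>2\<close>, which leaves
  \<open>r\<close>. For \<open>r = 2\<close> the sum is \<open>1 + q\<close>, and the condition
  modulo 4 makes it 2 modulo 4.\<close>

lemma square_not_dvd_sum_powers:
  fixes q r :: nat
  assumes r: "prime r" and q: "[q = 1] (mod r)" and two: "r = 2 \<Longrightarrow> q mod 4 \<noteq> 3"
  shows "\<not> r\<^sup>2 dvd (\<Sum>i<r. q ^ i)"
proof (cases "r = 2")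
  case True
  with q have "q mod 2 = 1" by (simp add: cong_def)
  then have "q mod 4 = 1 \<or> q mod 4 = 3" by presburger
  then have "(1 + q) mod 4 = 2" using two True by presburger
  moreover have "(\<Sum>i<(2::nat). q ^ i) = 1 + q"
    by (simp add: numeral_2_eq_2)
  ultimately show ?thesis
    using True by (simp add: dvd_eq_mod_eq_0)
next
  case False
  have "r > 1" using r by (rule prime_gt_1_nat)
  have "q \<noteq> 0" using q \<open>r > 1\<close> by (intro notI) (simp add: cong_def)
  with q have "r dvd q - 1" by (simp add: cong_altdef_nat cong_sym_eq Suc_leI)
  then obtain t where "q - 1 = r * t" by blast
  with \<open>q \<noteq> 0\<close> have t: "q = 1 + r * t" by simp
  have "odd r" using r False primes_dvd_imp_eq two_is_prime_nat by blast
  then obtain s where s: "r = 2 * s + 1" by (elim oddE)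
  have "(\<Sum>i<r. i) = r * s"
    using gauss_sum_nat[of "2 * s"] s by (simp add: lessThan_Suc_atMost atMost_atLeast0)
  then have sum: "r + r * t * (\<Sum>i<r. i) = r + r\<^sup>2 * (t * s)"
    by (simp add: power2_eq_square)
  have "[(\<Sum>i<r. q ^ i) = r + r\<^sup>2 * (t * s)] (mod r\<^sup>2)"
    using sum_powers_cong_square[of r t r] unfolding t sum .
  then have "[(\<Sum>i<r. q ^ i) = r] (mod r\<^sup>2)"
    by (simp add: cong_def)
  moreover have "\<not> r\<^sup>2 dvd r"
    using \<open>r > 1\<close> by (auto simp: power2_eq_square dest: dvd_imp_le)
  ultimately show ?thesis
    using cong_dvd_iff by blast
qed

text \<open>With \<open>n = r * m\<close>, \<open>k = r * k'\<close> and \<open>r * u\<close> the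
  sum of length \<open>r\<close>, the claim becomes \<open>m dvd u * S\<close> iff
  \<open>m dvd k'\<close>, where \<open>S\<close> is the sum of length \<open>k'\<close> for
  \<open>q ^ r\<close>. Coprimality of \<open>m\<close> and \<open>u\<close> removes
  \<open>u\<close>, and induction does the rest.\<close>

lemma dvd_sum_powers_iff:
  fixes q n k :: nat
  assumes "n > 0" "\<And>r. prime r \<Longrightarrow> r dvd n \<Longrightarrow> [q = 1] (mod r)" "q mod 4 = 3 \<Longrightarrow> \<not> 4 dvd n"
  shows "n dvd (\<Sum>i<k. q ^ i) \<longleftrightarrow> n dvd k"
  using assms
proof (induction n arbitrary: q k rule: less_induct)
  case (less n)
  show ?case
  proof (cases "n = 1")
    case False
    then obtain r where r: "prime r" "r dvd n" using prime_factor_nat by blast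
    from r(2) obtain m where m: "n = r * m" by blast
    have qr: "[q = 1] (mod r)" using less.prems r by blast
    have r1: "r > 1" using r(1) prime_gt_1_nat by blast
    have dvdr: "r dvd (\<Sum>i<k. q ^ i) \<longleftrightarrow> r dvd k" for k
      using sum_powers_cong[OF qr] cong_dvd_iff by blast
    show ?thesis
    proof (cases "r dvd k")
      case True
      then obtain k' where k': "k = r * k'" by blast
      from dvdr[of r] obtain u where u: "(\<Sum>i<r. q ^ i) = r * u" by auto
      \<comment> \<open>A common prime \<open>s = r\<close> would put \<open>r\<^sup>2\<close> into
        the sum of length \<open>r\<close>. Any other \<open>s\<close> would divide
        \<open>r\<close>, as \<open>r * u\<close> is congruent to \<open>r\<close> modulo
        \<open>s\<close>.\<close>
      have "coprime m u"
      proof (rule ccontr)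
        assume "\<not> coprime m u"
        then have "gcd m u \<noteq> 1" by (simp add: coprime_iff_gcd_eq_1)
        then obtain s where "prime s" "s dvd gcd m u" using prime_factor_nat by blast
        then have s: "prime s" "s dvd m" "s dvd u" by auto
        show False
        proof (cases "s = r")
          case True
          have "\<not> r\<^sup>2 dvd (\<Sum>i<r. q ^ i)"
          proof (rule square_not_dvd_sum_powers[OF r(1) qr])
            assume "r = 2"
            then have "4 dvd n" using True s(2) m by auto
            then show "q mod 4 \<noteq> 3" using less.prems(3) by blast
          qed
          then show False using u s(3) True by (simp add: power2_eq_square)
        next
          case False
          have "[q = 1] (mod s)" using less.prems(2) s m by auto
          then have "[r * u = r] (mod s)" using sum_powers_cong[of q s r] u by simp
          then have "s dvd r" using s(3) cong_dvd_iff dvd_mult by blast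
          then show False using False s(1) r(1) primes_dvd_imp_eq by blast
        qed
      qed
      moreover have "m dvd (\<Sum>j<k'. (q ^ r) ^ j) \<longleftrightarrow> m dvd k'"
      proof (rule less.IH)
        show "m < n" "m > 0" using m r1 less.prems(1) by auto
        show "[q ^ r = 1] (mod s)" if "prime s" "s dvd m" for s
          using cong_pow[of q 1 s r] less.prems(2)[of s] that m by auto
        \<comment> \<open>The condition modulo 4 is inherited, since this residue of
          \<open>q ^ r\<close> forces \<open>q mod 4 = 3\<close>.\<close>
        assume 3: "q ^ r mod 4 = 3"
        have "q mod 4 \<noteq> 1"
        proof
          assume "q mod 4 = 1"
          then have "[q ^ r = 1 ^ r] (mod 4)" by (intro cong_pow) (simp add: cong_def)
          then show False using 3 by (simp add: cong_def)
        qed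
        moreover have "odd (q ^ r)" using 3 by presburger
        then have "odd q" using r1 by simp
        ultimately have "q mod 4 = 3" by presburger
        then show "\<not> 4 dvd m" using less.prems(3) m by auto
      qed
      ultimately show ?thesis
        using r1 by (simp add: m k' sum_powers_mult u mult.assoc coprime_dvd_mult_right_iff)
    next
      case False
      then show ?thesis using dvdr r(2) dvd_trans by blast
    qed
  qed simp
qed

section \<open>Cosets in cyclic groups and power maps on finite fields\<close>

text \<open>Exponents of \<open>g\<close> are determined modulo \<open>ord g\<close>, so their
  residues modulo the divisor \<open>n\<close> are well defined.\<close>

lemma (in group) pow_in_coset_generate_pow_iff:
  fixes a b n :: nat
  assumes g: "g \<in> carrier G" and n: "n dvd ord g"
  shows "g [^] a \<in> (g [^] b) <# generate G {g [^] n} \<longleftrightarrow> [a = b] (mod n)"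
proof -
  have "(g [^] b) \<otimes> ((g [^] n) [^] (j::int)) = g [^] (int b + int n * j)" for j
    using g by (simp add: int_pow_int[symmetric] int_pow_pow int_pow_mult)
  then have "g [^] a \<in> (g [^] b) <# generate G {g [^] n} \<longleftrightarrow>
      (\<exists>j. g [^] int a = g [^] (int b + int n * j))"
    using g by (auto simp: l_coset_def generate_pow int_pow_int)
  also have "\<dots> \<longleftrightarrow> (\<exists>j. int (ord g) dvd int b + int n * j - int a)"
    using g by (simp add: int_pow_eq)
  also have "\<dots> \<longleftrightarrow> int n dvd int a - int b"
  proof
    assume "\<exists>j. int (ord g) dvd int b + int n * j - int a"
    then obtain j where "int (ord g) dvd int b + int n * j - int a" by blast
    with n have "int n dvd int b + int n * j - int a"
      by (meson dvd_trans int_dvd_int_iff)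
    from dvd_diff[OF dvd_triv_left this]
    have "int n dvd int n * j - (int b + int n * j - int a)" .
    then show "int n dvd int a - int b" by simp
  next
    assume "int n dvd int a - int b"
    then obtain j where "int a - int b = int n * j" by blast
    then have "int b + int n * j - int a = 0" by simp
    then show "\<exists>j. int (ord g) dvd int b + int n * j - int a" by (metis dvd_0_right)
  qed
  finally show ?thesis by (simp add: cong_iff_dvd_diff flip: cong_int_iff)
qed

lemma (in field) pow_order_minus_1:
  assumes "finite (carrier R)" "x \<in> carrier R" "x \<noteq> \<zero>"
  shows "x [^] (order R - 1) = \<one>"
proof -
  interpret M: group "mult_of R" by (rule field_mult_group)
  show ?thesis
    using M.pow_order_eq_1[of x] assms by (simp add: order_mult_of nat_pow_mult_of)
qed

lemma (in field) pow_order_eq_self: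
  assumes "finite (carrier R)" "x \<in> carrier R"
  shows "x [^] order R = x"
proof -
  have "order R > 0" using assms by (auto simp: order_def card_gt_0_iff)
  then have "x [^] order R = x [^] (order R - 1) \<otimes> x"
    by (metis Suc_diff_1 nat_pow_Suc)
  then show ?thesis
    using assms pow_order_minus_1 \<open>order R > 0\<close> by (cases "x = \<zero>") auto
qed

lemma (in field) subfield_pow_card_eq_self:
  assumes K: "subfield K R" "finite K" "x \<in> K"
  shows "x [^] card K = x"
  using field.pow_order_eq_self[OF subfield_iff(2)[OF K(1)], of x] K
  by (simp add: order_def flip: nat_pow_consistent)

lemma (in monoid) pow_power_eq_self:
  assumes "x \<in> carrier G" "x [^] (q::nat) = x"
  shows "x [^] (q ^ k) = x"
  using assms by (induction k) (simp_all flip: nat_pow_pow)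

section \<open>The Dickson index of the subfield elements\<close>

lemma q_bracket_eq_sum:
  assumes "q > 1"
  shows "q_bracket q k = (\<Sum>i<k. q ^ i)"
  unfolding q_bracket_def power_minus_1_eq_sum_nat using assms by simp

lemma dickson_pair_dvd_q_bracket_iff:
  assumes "dickson_pair q n" "q > 1"
  shows "n dvd q_bracket q k \<longleftrightarrow> n dvd k"
  unfolding q_bracket_eq_sum[OF assms(2)]
proof (rule dvd_sum_powers_iff)
  show "n > 0" "q mod 4 = 3 \<Longrightarrow> \<not> 4 dvd n"
    using assms by (auto simp: dickson_pair_def)
  show "[q = 1] (mod r)" if "prime r" "r dvd n" for r
    using assms that by (simp add: dickson_pair_def cong_altdef_nat)
qed

lemma dickson_index_eq_n:
  assumes pair: "dickson_pair q n" and q: "q > 1"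
    and F: "field F" "order F = q ^ n"
    and g: "g \<in> carrier (mult_of F)" "generate (mult_of F) {g} = carrier (mult_of F)"
    and x: "x \<in> carrier F" "x \<noteq> \<zero>\<^bsub>F\<^esub>" "x [^]\<^bsub>F\<^esub> (q - 1) = \<one>\<^bsub>F\<^esub>"
  shows "dickson_index F q n g x = n"
proof -
  interpret field F by fact
  interpret M: group "mult_of F" by (rule field_mult_group)
  have "n > 0" using pair by (simp add: dickson_pair_def)
  have fin: "finite (carrier F)"
    using F(2) q by (intro card_ge_0_finite) (simp add: order_def)
  have ord: "M.ord g = q ^ n - 1"
    using M.generate_pow_card[OF g(1)] g(2) F(2) order_mult_of[OF fin] by (simp add: order_def)
  have bracket: "q ^ n - 1 = (q - 1) * q_bracket q n"
    unfolding q_bracket_eq_sum[OF q] by (rule power_minus_1_eq_sum_nat)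
  have n_dvd: "n dvd q_bracket q n"
    using dickson_pair_dvd_q_bracket_iff[OF pair q] by simp
  have "x \<in> generate (mult_of F) {g}" using x g by simp
  then obtain e :: nat where e: "x = g [^]\<^bsub>mult_of F\<^esub> e"
    using M.generate_pow_on_finite_carrier[OF finite_mult_of[OF fin] g(1)] by auto
  have "g [^]\<^bsub>mult_of F\<^esub> (e * (q - 1)) = \<one>\<^bsub>mult_of F\<^esub>"
    using x(3) e M.nat_pow_pow[OF g(1)] by (simp add: nat_pow_mult_of)
  \<comment> \<open>The left side is the order of \<open>g\<close>. Cancelling \<open>q - 1\<close>
    shows that \<open>e\<close> is a multiple of \<open>q_bracket q n\<close>, hence of
    \<open>n\<close>.\<close>
  then have "(q - 1) * q_bracket q n dvd (q - 1) * e"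
    using M.pow_eq_id[OF g(1)] ord bracket by (simp add: mult.commute)
  then have "q_bracket q n dvd e" using q by simp
  then have "n dvd e" using n_dvd dvd_trans by blast
  have coset: "x \<in> (g [^]\<^bsub>mult_of F\<^esub> q_bracket q k) <#\<^bsub>mult_of F\<^esub> dickson_H F n g \<longleftrightarrow> n dvd k" for k
  proof -
    have "n dvd M.ord g" using ord bracket n_dvd by simp
    then have "x \<in> (g [^]\<^bsub>mult_of F\<^esub> q_bracket q k) <#\<^bsub>mult_of F\<^esub> dickson_H F n g
        \<longleftrightarrow> [e = q_bracket q k] (mod n)"
      using M.pow_in_coset_generate_pow_iff[OF g(1)] e by (simp add: dickson_H_def)
    also have "\<dots> \<longleftrightarrow> n dvd q_bracket q k"
      using \<open>n dvd e\<close> by (auto simp: cong_def dvd_eq_mod_eq_0)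
    finally show ?thesis using dickson_pair_dvd_q_bracket_iff[OF pair q] by simp
  qed
  \<comment> \<open>The only multiple of \<open>n\<close> in \<open>{1..n}\<close> is
    \<open>n\<close> itself, which gives both existence and uniqueness for the definite
    description.\<close>
  show ?thesis
    unfolding dickson_index_def coset
    using \<open>n > 0\<close> by (intro the_equality) (auto dest: dvd_imp_le)
qed

theorem theorem2p6:
  fixes F :: "('a, 'b) ring_scheme" and K :: "'a set" and g :: 'a and p l q n :: nat
  assumes "prime p" and "l > 0" and "n > 0" and "q = p ^ l"
    and "dickson_pair q n"
    and "field F" and "order F = q ^ n"
    and "g \<in> carrier (mult_of F)"
    and "generate (mult_of F) {g} = carrier (mult_of F)"
    and "subfield K F" and "card K = q"
  shows "K \<subseteq> mult_center (dickson_nearfield F q n g)"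
proof
  fix x assume xK: "x \<in> K"
  interpret field F by fact
  have q: "q > 1" using assms(1,2,4) prime_gt_1_nat one_less_power by metis
  have fin: "finite (carrier F)"
    using \<open>order F = q ^ n\<close> q by (intro card_ge_0_finite) (simp add: order_def)
  have "finite K" using \<open>card K = q\<close> q by (intro card_ge_0_finite) simp
  have x: "x \<in> carrier F" using subringE(1)[OF subfieldE(1)[OF \<open>subfield K F\<close>]] xK by blast
  have xq: "x [^]\<^bsub>F\<^esub> q = x"
    using subfield_pow_card_eq_self[OF \<open>subfield K F\<close> \<open>finite K\<close> xK] \<open>card K = q\<close> by simp
  \<comment> \<open>Zero lies in no coset and has no meaningful index; \<open>dickson_mult\<close>
    treats it separately.\<close>
  have index: "dickson_index F q n g x = n" if "x \<noteq> \<zero>\<^bsub>F\<^esub>"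
  proof (rule dickson_index_eq_n[OF \<open>dickson_pair q n\<close> q assms(6-9) x that])
    have "x [^]\<^bsub>F\<^esub> (q - 1) \<otimes>\<^bsub>F\<^esub> x = \<one>\<^bsub>F\<^esub> \<otimes>\<^bsub>F\<^esub> x"
      using q x xq nat_pow_Suc[of x "q - 1"] by simp
    then show "x [^]\<^bsub>F\<^esub> (q - 1) = \<one>\<^bsub>F\<^esub>"
      using m_rcancel[of x "x [^]\<^bsub>F\<^esub> (q - 1)" "\<one>\<^bsub>F\<^esub>"] that x by simp
  qed
  have "dickson_mult F q n g x y = dickson_mult F q n g y x" if y: "y \<in> carrier F" for y
  proof -
    have "y [^]\<^bsub>F\<^esub> (q ^ n) = y"
      using pow_order_eq_self[OF fin y] \<open>order F = q ^ n\<close> by simp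
    moreover have "x [^]\<^bsub>F\<^esub> (q ^ k) = x" for k
      using x xq by (rule pow_power_eq_self)
    ultimately show ?thesis
      \<comment> \<open>If one factor is zero, both products vanish because \<open>q > 1\<close>
        makes the exponents nonzero.\<close>
      using x y q index m_comm[OF x y] by (auto simp: dickson_mult_def nat_pow_zero)
  qed
  then show "x \<in> mult_center (dickson_nearfield F q n g)"
    using x by (simp add: mult_center_def dickson_nearfield_def)
qed

end
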